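(* Let $\sigma:\{\pm1\}^d\to[0,1]$ satisfy $\sigma(\mathbf{g})=\sigma(-\mathbf{g})$ and $\mathbf{E}_{\mathbf{g}\sim\mathsf{Unif}(\{\pm1\}^d)}[\sigma(\mathbf{g})]=p\in(0,1)$. Then, with an absolute implied constant, $$\mathsf{TV}\Big(\mathsf{RAG}(n,\{\pm1\}^d,\sigma,p),\ \mathsf{G}(n,p)\Big)^2 = O\!\left(\frac{n^3\sum_{i=1}^d\mathbf{Inf}_i[\sigma]^2}{p^2(1-p)^2}\right).$$
   Context: $\mathsf{RAG}(n,\{\pm1\}^d,\sigma,p)$ is the random graph on $[n]$ obtained by sampling $\mathbf{x}^1,\dots,\mathbf{x}^n$ iid uniform on the group $\{\pm1\}^d$ (coordinatewise multiplication) and, conditionally on them, including each edge $ij$ independently with probability $\sigma(\mathbf{x}^i\cdot\mathbf{x}^j)$ (the group "difference", here the coordinatewise product). $\mathsf{G}(n,p)$ is Erdős–Rényi. For $f:\{\pm1\}^d\to\mathbb{R}$, the influence of coordinate $i$ is $\mathbf{Inf}_i[f]=\mathbf{E}_{\mathbf{x}}[(f(\mathbf{x})-f(\mathbf{x}^{\oplus i}))^2/4]=\sum_{S\ni i}\hat f(S)^2$, where $\mathbf{x}^{\oplus i}$ is $\mathbf{x}$ with the $i$-th coordinate flipped and $\hat f(S)$ are the Fourier–Walsh coefficients. *)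

theory Defs
  imports "HOL-Library.FuncSet" Complex_Main
begin

definition cube :: "nat \<Rightarrow> int list set" where
  "cube d = {x. length x = d \<and> set x \<subseteq> {-1, 1}}"

definition cmul :: "int list \<Rightarrow> int list \<Rightarrow> int list" where
  "cmul x y = map2 (*) x y"

definition cneg :: "int list \<Rightarrow> int list" where
  "cneg x = map uminus x"

definition flip :: "nat \<Rightarrow> int list \<Rightarrow> int list" where
  "flip i x = x[i := - (x ! i)]"

definition cube_expect :: "nat \<Rightarrow> (int list \<Rightarrow> real) \<Rightarrow> real" where
  "cube_expect d f = (\<Sum>x\<in>cube d. f x) / 2 ^ d"

definition influence :: "nat \<Rightarrow> (int list \<Rightarrow> real) \<Rightarrow> nat \<Rightarrow> real" where
  "influence d f i = cube_expect d (\<lambda>x. (f x - f (flip i x))\<^sup>2 / 4)"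

definition vpairs :: "nat \<Rightarrow> (nat \<times> nat) set" where
  "vpairs n = {(i, j). i < j \<and> j < n}"

definition rag_prob :: "nat \<Rightarrow> nat \<Rightarrow> (int list \<Rightarrow> real) \<Rightarrow> (nat \<times> nat) set \<Rightarrow> real" where
  "rag_prob n d \<sigma> E =
     (\<Sum>X\<in>PiE {..<n} (\<lambda>_. cube d).
        \<Prod>(i, j)\<in>vpairs n. (if (i, j) \<in> E then \<sigma> (cmul (X i) (X j))
                                           else 1 - \<sigma> (cmul (X i) (X j)))) / 2 ^ (d * n)"

definition gnp_prob :: "nat \<Rightarrow> real \<Rightarrow> (nat \<times> nat) set \<Rightarrow> real" where
  "gnp_prob n p E = (\<Prod>(i, j)\<in>vpairs n. (if (i, j) \<in> E then p else 1 - p))"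

definition tv_rag_gnp :: "nat \<Rightarrow> nat \<Rightarrow> (int list \<Rightarrow> real) \<Rightarrow> real \<Rightarrow> real" where
  "tv_rag_gnp n d \<sigma> p = (\<Sum>E\<in>Pow (vpairs n). \<bar>rag_prob n d \<sigma> E - gnp_prob n p E\<bar>) / 2"

end

theory Submission
  imports Defs "HOL-Analysis.Convex"
begin

text \<open>
  The squared total variation distance is at most the KL divergence, and the latter is accumulated
  by revealing the graph vertex by vertex. Conditionally on the latent vectors of the first \<open>k\<close>
  vertices, the \<open>\<chi>\<^sup>2\<close> divergence of the next row of edges from a product of Bernoulli variables has
  mean \<open>E (1 + \<gamma> / (p (1 - p)))\<^sup>k - 1\<close>, where \<open>\<gamma>\<close> is the autocorrelation of \<open>\<sigma> - p\<close>. Flipping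
  coordinate \<open>i\<close> changes \<open>\<gamma>\<close> by at most \<open>2 Inf\<^sub>i[\<sigma>]\<close>, and \<open>\<gamma>\<close> has mean zero, so the bounded-differences
  bound for exponential moments gives at most \<open>exp (k\<^sup>2 v / 2) - 1\<close> with
  \<open>v = \<Sum>\<^sub>i Inf\<^sub>i[\<sigma>]\<^sup>2 / (p (1 - p))\<^sup>2\<close>. Summing over \<open>k < n\<close> yields \<open>n\<^sup>3 v\<close> when \<open>n\<^sup>2 v \<le> 1\<close>;
  otherwise the claim is trivial, as total variation never exceeds 1.
\<close>

section \<open>KL divergence of finite distributions\<close>

text \<open>An outcome with \<open>P a = 0\<close> contributes 0 through its factor, which is the
  usual convention; \<open>Q\<close> is assumed positive wherever the divergence is
  estimated.\<close>

definition kl_div :: "'a set \<Rightarrow> ('a \<Rightarrow> real) \<Rightarrow> ('a \<Rightarrow> real) \<Rightarrow> real" where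
  "kl_div A P Q = (\<Sum>a\<in>A. P a * ln (P a / Q a))"

lemma tv_sq_le_kl_div:
  fixes P Q :: "'a \<Rightarrow> real"
  assumes P: "\<And>a. a \<in> A \<Longrightarrow> 0 \<le> P a" and Q: "\<And>a. a \<in> A \<Longrightarrow> 0 < Q a"
    and sP: "sum P A = 1" and sQ: "sum Q A = 1"
  shows "((\<Sum>a\<in>A. \<bar>P a - Q a\<bar>) / 2)\<^sup>2 \<le> kl_div A P Q"
proof -
  \<comment> \<open>\<open>H\<close> is the squared Hellinger distance, and TV\<open>\<^sup>2 \<le> H \<le>\<close> KL.\<close>
  define H where "H = (\<Sum>a\<in>A. \<bar>sqrt (P a) - sqrt (Q a)\<bar>\<^sup>2)"
  define B where "B = (\<Sum>a\<in>A. sqrt (P a) * sqrt (Q a))"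
  have sq: "(sqrt (P a))\<^sup>2 = P a" "(sqrt (Q a))\<^sup>2 = Q a" if "a \<in> A" for a
    using P[OF that] Q[OF that] by auto
  have H: "H = 2 - 2 * B"
  proof -
    have "H = (\<Sum>a\<in>A. P a + Q a - 2 * (sqrt (P a) * sqrt (Q a)))"
      unfolding H_def by (intro sum.cong) (auto simp: power2_diff sq)
    then show ?thesis
      by (simp add: sum.distrib sum_subtractf sP sQ B_def sum_distrib_left)
  qed
  have S: "(\<Sum>a\<in>A. (sqrt (P a) + sqrt (Q a))\<^sup>2) = 2 + 2 * B"
  proof -
    have "(\<Sum>a\<in>A. (sqrt (P a) + sqrt (Q a))\<^sup>2) = (\<Sum>a\<in>A. P a + Q a + 2 * (sqrt (P a) * sqrt (Q a)))"
      by (intro sum.cong) (auto simp: power2_sum sq)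
    then show ?thesis
      by (simp add: sum.distrib sP sQ B_def sum_distrib_left)
  qed
  have H0: "H \<ge> 0" unfolding H_def by (intro sum_nonneg) auto
  have "(\<Sum>a\<in>A. \<bar>P a - Q a\<bar>) = (\<Sum>a\<in>A. \<bar>sqrt (P a) - sqrt (Q a)\<bar> * (sqrt (P a) + sqrt (Q a)))"
  proof (rule sum.cong)
    fix a assume a: "a \<in> A"
    have "P a - Q a = (sqrt (P a) - sqrt (Q a)) * (sqrt (P a) + sqrt (Q a))"
      using sq[OF a] by (simp add: algebra_simps power2_eq_square)
    then show "\<bar>P a - Q a\<bar> = \<bar>sqrt (P a) - sqrt (Q a)\<bar> * (sqrt (P a) + sqrt (Q a))"
      using P[OF a] Q[OF a] by (simp add: abs_mult)
  qed simp
  then have "(\<Sum>a\<in>A. \<bar>P a - Q a\<bar>)\<^sup>2 \<le> H * (2 + 2 * B)"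
    unfolding S[symmetric] H_def by (simp only: Cauchy_Schwarz_ineq_sum)
  \<comment> \<open>\<open>H = 2 - 2 * B\<close> together with \<open>H \<ge> 0\<close> gives
    \<open>B \<le> 1\<close>, so the second Cauchy-Schwarz factor is at most 4, which the halving in
    the total variation absorbs.\<close>
  also have "\<dots> \<le> H * 4"
    using H H0 by (intro mult_left_mono) auto
  finally have 1: "((\<Sum>a\<in>A. \<bar>P a - Q a\<bar>) / 2)\<^sup>2 \<le> H"
    by (simp add: power_divide)
  \<comment> \<open>The pointwise form of \<open>H \<le> kl_div A P Q\<close>: apply
    \<open>ln u \<le> u - 1\<close> to \<open>u = sqrt (Q a / P a)\<close>. Summation with
    \<open>sum P A = 1\<close> turns the right side into \<open>2 - 2 * B\<close>.\<close>
  have "P a * ln (P a / Q a) \<ge> 2 * P a - 2 * (sqrt (P a) * sqrt (Q a))" if a: "a \<in> A" for a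
  proof (cases "P a = 0")
    case False
    with P[OF a] have pos: "P a > 0" "Q a > 0" using Q[OF a] by auto
    have "ln (sqrt (Q a / P a)) \<le> sqrt (Q a / P a) - 1"
      using pos by (intro ln_le_minus_one) auto
    then have "ln (P a / Q a) \<ge> 2 - 2 * sqrt (Q a / P a)"
      using pos by (simp add: ln_sqrt ln_div)
    then have "P a * ln (P a / Q a) \<ge> P a * (2 - 2 * sqrt (Q a / P a))"
      using pos by (intro mult_left_mono) auto
    moreover have "P a * sqrt (Q a / P a) = sqrt (P a) * sqrt (Q a)"
      using pos by (simp add: real_sqrt_divide field_simps)
    ultimately show ?thesis by (simp add: algebra_simps)
  qed simp
  then have "kl_div A P Q \<ge> (\<Sum>a\<in>A. 2 * P a - 2 * (sqrt (P a) * sqrt (Q a)))"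
    unfolding kl_div_def by (intro sum_mono) auto
  also have "(\<Sum>a\<in>A. 2 * P a - 2 * (sqrt (P a) * sqrt (Q a))) = H"
    unfolding H B_def by (simp add: sum_subtractf sum_distrib_left[symmetric] sP)
  finally show ?thesis using 1 by simp
qed

text \<open>
  The chain rule combined with \<open>KL \<le> \<chi>\<^sup>2\<close> for the conditional law of \<open>t\<close> given \<open>g\<close>. The latent variable \<open>X\<close>
  is pulled out of the \<open>\<chi>\<^sup>2\<close> term by Cauchy--Schwarz, \<open>J\<^sup>2 \<le> P \<cdot> E[W r\<^sup>2]\<close>.
\<close>

lemma kl_div_mixture_step:
  fixes \<mu> :: "'x \<Rightarrow> real" and W :: "'g \<Rightarrow> 'x \<Rightarrow> real" and r :: "'r \<Rightarrow> 'x \<Rightarrow> real"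
  assumes \<mu>: "\<And>X. X \<in> S \<Longrightarrow> 0 \<le> \<mu> X" "sum \<mu> S = 1"
    and W: "\<And>g X. g \<in> A \<Longrightarrow> X \<in> S \<Longrightarrow> 0 \<le> W g X" "\<And>X. X \<in> S \<Longrightarrow> (\<Sum>g\<in>A. W g X) = 1"
    and r: "\<And>t X. t \<in> T \<Longrightarrow> X \<in> S \<Longrightarrow> 0 \<le> r t X" "\<And>X. X \<in> S \<Longrightarrow> (\<Sum>t\<in>T. r t X) = 1"
    and Q: "\<And>g. g \<in> A \<Longrightarrow> 0 < Q g" and q: "\<And>t. t \<in> T \<Longrightarrow> 0 < q t"
  defines "P \<equiv> \<lambda>g. \<Sum>X\<in>S. \<mu> X * W g X"
  defines "J \<equiv> \<lambda>(g, t). \<Sum>X\<in>S. \<mu> X * W g X * r t X"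
  shows "kl_div (A \<times> T) J (\<lambda>(g, t). Q g * q t)
    \<le> kl_div A P Q + (\<Sum>X\<in>S. \<mu> X * (\<Sum>t\<in>T. (r t X)\<^sup>2 / q t)) - 1"
proof -
  \<comment> \<open>The share of \<open>(g, t)\<close> in the averaged \<chi>-square sum. Summing
    over \<open>g\<close> removes \<open>W\<close>, which has total mass 1 for each
    \<open>X\<close>, and leaves exactly the term in the conclusion.\<close>
  define D where "D = (\<lambda>g t. (\<Sum>X\<in>S. \<mu> X * W g X * (r t X)\<^sup>2) / q t)"
  have P0: "P g \<ge> 0" if "g \<in> A" for g
    unfolding P_def using that \<mu> W by (intro sum_nonneg mult_nonneg_nonneg) auto
  have J0: "J (g, t) \<ge> 0" if "g \<in> A" "t \<in> T" for g t
    unfolding J_def using that \<mu> W r by (auto intro!: sum_nonneg mult_nonneg_nonneg)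
  have JP: "(\<Sum>t\<in>T. J (g, t)) = P g" if "g \<in> A" for g
  proof -
    have "(\<Sum>t\<in>T. J (g, t)) = (\<Sum>X\<in>S. \<Sum>t\<in>T. \<mu> X * W g X * r t X)"
      unfolding J_def prod.case by (rule sum.swap)
    also have "\<dots> = P g"
      unfolding P_def by (intro sum.cong) (auto simp: sum_distrib_left[symmetric] r)
    finally show ?thesis .
  qed
  have P1: "sum P A = 1"
  proof -
    have "sum P A = (\<Sum>X\<in>S. \<Sum>g\<in>A. \<mu> X * W g X)"
      unfolding P_def by (rule sum.swap)
    also have "\<dots> = sum \<mu> S"
      by (intro sum.cong) (auto simp: sum_distrib_left[symmetric] W)
    finally show ?thesis using \<mu> by simp
  qed
  have D0: "D g t \<ge> 0" if "g \<in> A" "t \<in> T" for g t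
    unfolding D_def using that \<mu> W q[OF that(2)]
    by (intro divide_nonneg_pos sum_nonneg mult_nonneg_nonneg) auto
  have J2: "(J (g, t))\<^sup>2 \<le> P g * (q t * D g t)" if gt: "g \<in> A" "t \<in> T" for g t
  proof -
    have "J (g, t) = (\<Sum>X\<in>S. sqrt (\<mu> X * W g X) * (sqrt (\<mu> X * W g X) * r t X))"
      unfolding J_def prod.case using gt \<mu> W
      by (intro sum.cong) (auto simp: mult.assoc[symmetric])
    then have "(J (g, t))\<^sup>2 \<le> (\<Sum>X\<in>S. (sqrt (\<mu> X * W g X))\<^sup>2) *
        (\<Sum>X\<in>S. (sqrt (\<mu> X * W g X) * r t X)\<^sup>2)"
      by (simp only: Cauchy_Schwarz_ineq_sum)
    also have "(\<Sum>X\<in>S. (sqrt (\<mu> X * W g X))\<^sup>2) = P g"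
      unfolding P_def using gt \<mu> W by (intro sum.cong) auto
    also have "(\<Sum>X\<in>S. (sqrt (\<mu> X * W g X) * r t X)\<^sup>2) = q t * D g t"
      unfolding D_def using gt \<mu> W q[OF gt(2)] by (auto simp: power_mult_distrib intro!: sum.cong)
    finally show ?thesis .
  qed
  \<comment> \<open>The logarithm splits into the old ratio \<open>P g / Q g\<close> and the
    conditional ratio \<open>J (g, t) / (P g * q t)\<close>. The bound
    \<open>ln u \<le> u - 1\<close> on the latter, followed by \<open>J2\<close>, produces
    \<open>D g t - J (g, t)\<close>; the total mass of \<open>J\<close> is the final
    \<open>- 1\<close>.\<close>
  have key: "J (g, t) * ln (J (g, t) / (Q g * q t)) \<le> J (g, t) * ln (P g / Q g) + (D g t - J (g, t))"
    if gt: "g \<in> A" "t \<in> T" for g t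
  proof (cases "J (g, t) = 0")
    case True
    then show ?thesis using D0[OF gt] by simp
  next
    case False
    then have J: "J (g, t) > 0" using J0[OF gt] by simp
    have P: "P g > 0"
    proof (rule ccontr)
      assume "\<not> P g > 0"
      then have "P g = 0" using P0[OF gt(1)] by simp
      with J2[OF gt] J show False by simp
    qed
    have QQ: "Q g > 0" "q t > 0" using Q q gt by auto
    have "ln (J (g, t) / (P g * q t)) \<le> J (g, t) / (P g * q t) - 1"
      using J P QQ by (intro ln_le_minus_one) auto
    then have "J (g, t) * ln (J (g, t) / (P g * q t)) \<le> J (g, t) * (J (g, t) / (P g * q t) - 1)"
      using J by (intro mult_left_mono) auto
    also have "\<dots> = (J (g, t))\<^sup>2 / (P g * q t) - J (g, t)"
      by (simp add: algebra_simps power2_eq_square)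
    also have "\<dots> \<le> D g t - J (g, t)"
      using J2[OF gt] P QQ by (simp add: pos_divide_le_eq mult_ac)
    finally have 1: "J (g, t) * ln (J (g, t) / (P g * q t)) \<le> D g t - J (g, t)" .
    have "ln (J (g, t) / (Q g * q t)) = ln (P g / Q g) + ln (J (g, t) / (P g * q t))"
      using J P QQ by (simp add: ln_div ln_mult)
    with 1 show ?thesis by (simp add: distrib_left)
  qed
  have "kl_div (A \<times> T) J (\<lambda>(g, t). Q g * q t)
      = (\<Sum>g\<in>A. \<Sum>t\<in>T. J (g, t) * ln (J (g, t) / (Q g * q t)))"
    unfolding kl_div_def by (simp add: sum.cartesian_product split_def)
  also have "\<dots> \<le> (\<Sum>g\<in>A. \<Sum>t\<in>T. J (g, t) * ln (P g / Q g) + (D g t - J (g, t)))"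
    by (intro sum_mono key)
  also have "\<dots> = (\<Sum>g\<in>A. P g * ln (P g / Q g)) + ((\<Sum>g\<in>A. \<Sum>t\<in>T. D g t) - sum P A)"
    by (simp add: sum.distrib sum_subtractf JP flip: sum_distrib_right)
  also have "(\<Sum>g\<in>A. \<Sum>t\<in>T. D g t) = (\<Sum>X\<in>S. \<mu> X * (\<Sum>t\<in>T. (r t X)\<^sup>2 / q t))"
  proof -
    have "(\<Sum>g\<in>A. \<Sum>t\<in>T. D g t) = (\<Sum>g\<in>A. \<Sum>t\<in>T. \<Sum>X\<in>S. W g X * (\<mu> X * ((r t X)\<^sup>2 / q t)))"
      unfolding D_def by (simp add: sum_divide_distrib mult_ac)
    also have "\<dots> = (\<Sum>g\<in>A. \<Sum>X\<in>S. \<Sum>t\<in>T. W g X * (\<mu> X * ((r t X)\<^sup>2 / q t)))"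
      by (intro sum.cong refl sum.swap)
    also have "\<dots> = (\<Sum>X\<in>S. \<Sum>g\<in>A. \<Sum>t\<in>T. W g X * (\<mu> X * ((r t X)\<^sup>2 / q t)))"
      by (rule sum.swap)
    also have "\<dots> = (\<Sum>X\<in>S. (\<Sum>g\<in>A. W g X) * (\<Sum>t\<in>T. \<mu> X * ((r t X)\<^sup>2 / q t)))"
      by (simp add: sum_product)
    also have "\<dots> = (\<Sum>X\<in>S. \<mu> X * (\<Sum>t\<in>T. (r t X)\<^sup>2 / q t))"
      by (intro sum.cong) (auto simp: W sum_distrib_left)
    finally show ?thesis .
  qed
  finally show ?thesis unfolding kl_div_def P1 by simp
qed

section \<open>Bounded differences on the cube\<close>

text \<open>By evenness it suffices to take \<open>y \<ge> 0\<close>. There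
  \<open>cosh y * exp (- (y\<^sup>2 / 2))\<close> starts at 1 and does not increase, its derivative
  having the sign of \<open>sinh y - y * cosh y\<close>.\<close>

lemma cosh_le_exp_half_square: "cosh x \<le> exp (x\<^sup>2 / 2)" for x :: real
proof -
  have tc: "sinh y \<le> y * cosh y" if "y \<ge> 0" for y :: real
  proof -
    have "0 * cosh 0 - sinh 0 \<le> y * cosh y - sinh y"
    proof (rule DERIV_nonneg_imp_nondecreasing[OF that])
      fix z :: real assume "0 \<le> z"
      then have "z * sinh z \<ge> 0" by simp
      moreover have "((\<lambda>z. z * cosh z - sinh z) has_real_derivative z * sinh z) (at z)"
        by (auto intro!: derivative_eq_intros)
      ultimately show "\<exists>y. ((\<lambda>z. z * cosh z - sinh z) has_real_derivative y) (at z) \<and> 0 \<le> y"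
        by blast
    qed
    then show ?thesis by simp
  qed
  have main: "cosh y \<le> exp (y\<^sup>2 / 2)" if "y \<ge> 0" for y :: real
  proof -
    have "cosh y * exp (- (y\<^sup>2 / 2)) \<le> cosh 0 * exp (- (0\<^sup>2 / 2))"
    proof (rule DERIV_nonpos_imp_nonincreasing[OF that])
      fix z :: real assume "0 \<le> z"
      then have "(sinh z - z * cosh z) * exp (- (z\<^sup>2 / 2)) \<le> 0"
        using tc by (intro mult_nonpos_nonneg) auto
      moreover have "((\<lambda>z. cosh z * exp (- (z\<^sup>2 / 2))) has_real_derivative
          (sinh z - z * cosh z) * exp (- (z\<^sup>2 / 2))) (at z)"
        by (auto intro!: derivative_eq_intros simp: algebra_simps)
      ultimately show "\<exists>y. ((\<lambda>z. cosh z * exp (- (z\<^sup>2 / 2))) has_real_derivative y) (at z) \<and> y \<le> 0"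
        by blast
    qed
    then show ?thesis by (simp add: exp_minus field_simps)
  qed
  show ?thesis
    using main[of x] main[of "-x"] by (cases "x \<ge> 0") auto
qed

section \<open>The cube as a finite set, and exponential moments on it\<close>

lemma finite_cube [simp]: "finite (cube d)"
proof -
  have "cube d = {x. set x \<subseteq> {-1, 1} \<and> length x = d}" by (auto simp: cube_def)
  then show ?thesis using finite_lists_length_eq[of "{-1, 1 :: int}" d] by simp
qed

lemma card_cube [simp]: "card (cube d) = 2 ^ d"
proof -
  have "cube d = {x. set x \<subseteq> {-1, 1} \<and> length x = d}" by (auto simp: cube_def)
  then show ?thesis using card_lists_length_eq[of "{-1, 1 :: int}" d] by (simp add: numeral_2_eq_2)
qed

lemma cube_Suc: "cube (Suc d) = (#) 1 ` cube d \<union> (#) (-1) ` cube d"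
  by (auto simp: cube_def length_Suc_conv image_iff)

lemma sum_cube_Suc:
  "(\<Sum>x\<in>cube (Suc d). f x) = (\<Sum>x\<in>cube d. f (1 # x) + f ((-1) # x))"
  for f :: "int list \<Rightarrow> real"
  unfolding cube_Suc
  by (subst sum.union_disjoint) (auto simp: sum.reindex sum.distrib)

lemma cube_0: "cube 0 = {[]}"
  by (auto simp: cube_def)

text \<open>Induction on \<open>d\<close>, averaging out the first coordinate. The two values above
  a tail \<open>x\<close> are \<open>a x \<plusminus> b\<close> with
  \<open>\<bar>b\<bar> \<le> c 0\<close>, so their exponentials average to
  \<open>exp (a x) * cosh b\<close>. The function \<open>a\<close> keeps the mean of
  \<open>f\<close> and inherits the difference bounds with indices shifted by one.\<close>

lemma cube_expect_exp_le:
  assumes "\<And>i x. i < d \<Longrightarrow> x \<in> cube d \<Longrightarrow> \<bar>f x - f (flip i x)\<bar> \<le> 2 * c i"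
  shows "cube_expect d (\<lambda>x. exp (f x)) \<le> exp (cube_expect d f + (\<Sum>i<d. (c i)\<^sup>2) / 2)"
  using assms
proof (induction d arbitrary: f c)
  case 0
  then show ?case by (simp add: cube_expect_def cube_0)
next
  case (Suc d)
  define a where "a = (\<lambda>x. (f (1 # x) + f ((-1) # x)) / 2)"
  have mem: "1 # x \<in> cube (Suc d)" "(-1) # x \<in> cube (Suc d)" if "x \<in> cube d" for x
    using that by (auto simp: cube_def)
  have diff: "\<bar>a x - a (flip i x)\<bar> \<le> 2 * c (Suc i)" if "i < d" "x \<in> cube d" for i x
    using Suc.prems[of "Suc i" "1 # x"] Suc.prems[of "Suc i" "(-1) # x"] that mem[OF that(2)]
    by (simp add: a_def flip_def abs_le_iff field_simps)
  have pt: "(exp (f (1 # x)) + exp (f ((-1) # x))) / 2 \<le> exp (a x) * exp ((c 0)\<^sup>2 / 2)"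
    if x: "x \<in> cube d" for x
  proof -
    define b where "b = (f (1 # x) - f ((-1) # x)) / 2"
    have f: "f (1 # x) = a x + b" "f ((-1) # x) = a x - b"
      by (simp_all add: a_def b_def field_simps)
    have "\<bar>b\<bar> \<le> c 0"
      using Suc.prems[of 0 "1 # x"] mem[OF x] by (simp add: b_def flip_def)
    then have "b\<^sup>2 \<le> (c 0)\<^sup>2"
      using power_mono[of "\<bar>b\<bar>" "c 0" 2] by simp
    have "(exp (f (1 # x)) + exp (f ((-1) # x))) / 2 = exp (a x) * cosh b"
      unfolding f by (simp add: cosh_field_def exp_add exp_diff exp_minus field_simps)
    also have "\<dots> \<le> exp (a x) * exp ((c 0)\<^sup>2 / 2)"
      using cosh_le_exp_half_square[of b] \<open>b\<^sup>2 \<le> (c 0)\<^sup>2\<close>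
      by (intro mult_left_mono) (auto intro: order_trans)
    finally show ?thesis .
  qed
  have "cube_expect (Suc d) (\<lambda>x. exp (f x))
      = (\<Sum>x\<in>cube d. (exp (f (1 # x)) + exp (f ((-1) # x))) / 2) / 2 ^ d"
    by (simp add: cube_expect_def sum_cube_Suc flip: sum_divide_distrib)
  also have "\<dots> \<le> (\<Sum>x\<in>cube d. exp (a x) * exp ((c 0)\<^sup>2 / 2)) / 2 ^ d"
    by (intro divide_right_mono sum_mono pt) auto
  also have "\<dots> = cube_expect d (\<lambda>x. exp (a x)) * exp ((c 0)\<^sup>2 / 2)"
    by (simp add: cube_expect_def flip: sum_distrib_right)
  also have "\<dots> \<le> exp (cube_expect d a + (\<Sum>i<d. (c (Suc i))\<^sup>2) / 2) * exp ((c 0)\<^sup>2 / 2)"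
    by (intro mult_right_mono Suc.IH diff) auto
  also have "cube_expect d a = cube_expect (Suc d) f"
    by (simp add: cube_expect_def sum_cube_Suc a_def flip: sum_divide_distrib)
  finally show ?case
    by (simp add: sum.lessThan_Suc_shift add_divide_distrib add_ac del: sum.lessThan_Suc flip: exp_add)
qed

section \<open>Group structure of the cube and coordinate flips\<close>

lemma cmul_in_cube [simp]: "x \<in> cube d \<Longrightarrow> y \<in> cube d \<Longrightarrow> cmul x y \<in> cube d"
  by (fastforce simp: cube_def cmul_def set_zip subset_iff in_set_conv_nth)

lemma cube_nth: "x \<in> cube d \<Longrightarrow> i < d \<Longrightarrow> x ! i \<in> {-1, 1}"
  unfolding cube_def using nth_mem by blast

lemma cube_nth_square: "x \<in> cube d \<Longrightarrow> i < d \<Longrightarrow> x ! i * x ! i = 1"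
  using cube_nth[of x d i] by auto

text \<open>Every element is its own inverse, so translation by \<open>x\<close> is an involution;
  this justifies the changes of variables in cube sums.\<close>

lemma cmul_cancel: "x \<in> cube d \<Longrightarrow> y \<in> cube d \<Longrightarrow> cmul x (cmul x y) = y"
  using cube_nth_square[of x d]
  by (intro nth_equalityI) (auto simp: cmul_def cube_def simp flip: mult.assoc)

lemma cmul_commute: "cmul x y = cmul y x"
  by (rule nth_equalityI) (auto simp: cmul_def mult.commute)

lemma cmul_assoc: "cmul (cmul x y) z = cmul x (cmul y z)"
  by (rule nth_equalityI) (auto simp: cmul_def mult.assoc)

lemma flip_in_cube [simp]: "x \<in> cube d \<Longrightarrow> i < d \<Longrightarrow> flip i x \<in> cube d"
  using cube_nth[of x d i] set_update_subset_insert[of x i "- (x ! i)"]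
  unfolding cube_def flip_def by fastforce

lemma flip_flip [simp]: "flip i (flip i x) = x"
  by (cases "i < length x") (auto simp: flip_def list_update_beyond)

text \<open>An in-range flip is multiplication by the vector whose only -1 is in place
  \<open>i\<close>, so it commutes with translations.\<close>

lemma cmul_flip_left: "length x = length y \<Longrightarrow> cmul (flip i x) y = flip i (cmul x y)"
  by (cases "i < length x"; rule nth_equalityI) (auto simp: cmul_def flip_def nth_list_update list_update_beyond)

lemma cmul_flip_right: "length x = length y \<Longrightarrow> cmul x (flip i y) = flip i (cmul x y)"
  by (cases "i < length x"; rule nth_equalityI) (auto simp: cmul_def flip_def nth_list_update list_update_beyond)

lemma sum_cube_cmul:
  "y \<in> cube d \<Longrightarrow> (\<Sum>x\<in>cube d. f (cmul y x)) = (\<Sum>x\<in>cube d. f x)"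
  by (rule sum.reindex_bij_witness[of _ "cmul y" "cmul y"]) (auto simp: cmul_cancel)

lemma sum_cube_flip:
  "i < d \<Longrightarrow> (\<Sum>x\<in>cube d. f (flip i x)) = (\<Sum>x\<in>cube d. f x)"
  by (rule sum.reindex_bij_witness[of _ "flip i" "flip i"]) auto

section \<open>Autocorrelation\<close>

text \<open>The self-convolution of \<open>f\<close> on the group: its Fourier-Walsh coefficients
  are the squares of those of \<open>f\<close>.\<close>

definition autocorr :: "nat \<Rightarrow> (int list \<Rightarrow> real) \<Rightarrow> int list \<Rightarrow> real" where
  "autocorr d f x = cube_expect d (\<lambda>y. f y * f (cmul x y))"

text \<open>For fixed \<open>y\<close> the product \<open>cmul x y\<close> is uniform when
  \<open>x\<close> is, so the double average factors.\<close>

lemma cube_expect_autocorr: "cube_expect d (autocorr d f) = (cube_expect d f)\<^sup>2"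
proof -
  have "(\<Sum>x\<in>cube d. \<Sum>y\<in>cube d. f y * f (cmul x y)) = (\<Sum>y\<in>cube d. \<Sum>x\<in>cube d. f y * f (cmul y x))"
    by (subst sum.swap) (simp add: cmul_commute)
  also have "\<dots> = (\<Sum>y\<in>cube d. f y * (\<Sum>x\<in>cube d. f x))"
    by (intro sum.cong) (simp_all add: sum_cube_cmul flip: sum_distrib_left)
  finally show ?thesis
    by (simp add: autocorr_def cube_expect_def power2_eq_square sum_distrib_right flip: sum_divide_distrib)
qed

text \<open>The difference is the average of \<open>f y * ?h y\<close>, where \<open>?h\<close> is
  odd under the flip of coordinate \<open>i\<close>. Hence \<open>f\<close> may be replaced by its
  odd part, half of \<open>g\<close>. Then
  \<open>\<bar>u * w\<bar> \<le> (u\<^sup>2 + w\<^sup>2) / 2\<close> and translation invariance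
  leave half the mean of \<open>g\<^sup>2\<close>, which is twice the influence.\<close>

lemma autocorr_flip_le:
  assumes i: "i < d" and x: "x \<in> cube d"
  shows "\<bar>autocorr d f x - autocorr d f (flip i x)\<bar> \<le> 2 * influence d f i"
proof -
  define g where "g = (\<lambda>y. f y - f (flip i y))"
  let ?h = "\<lambda>y. g (cmul x y)"
  have len: "length x = length y" if "y \<in> cube d" for y
    using that x by (simp add: cube_def)
  have h: "?h (flip i y) = - ?h y" if "y \<in> cube d" for y
    using len[OF that] by (simp add: g_def cmul_flip_right)
  have 1: "autocorr d f x - autocorr d f (flip i x) = (\<Sum>y\<in>cube d. f y * ?h y) / 2 ^ d"
    unfolding autocorr_def cube_expect_def diff_divide_distrib[symmetric] sum_subtractf[symmetric]
    by (intro arg_cong2[of _ _ _ _ "(/)"] sum.cong)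
      (auto simp: g_def cmul_flip_left[OF len] algebra_simps)
  have "(\<Sum>y\<in>cube d. f y * ?h y) = (\<Sum>y\<in>cube d. f (flip i y) * ?h (flip i y))"
    using sum_cube_flip[OF i, of "\<lambda>y. f y * ?h y"] by simp
  also have "\<dots> = - (\<Sum>y\<in>cube d. f (flip i y) * ?h y)"
    by (simp add: h flip: sum_negf)
  finally have "2 * (\<Sum>y\<in>cube d. f y * ?h y) = (\<Sum>y\<in>cube d. g y * ?h y)"
    by (simp add: g_def left_diff_distrib sum_subtractf)
  moreover have "\<bar>\<Sum>y\<in>cube d. g y * ?h y\<bar> \<le> (\<Sum>y\<in>cube d. ((g y)\<^sup>2 + (?h y)\<^sup>2) / 2)"
  proof (rule order_trans[OF sum_abs sum_mono])
    fix y
    have "0 \<le> (\<bar>g y\<bar> - \<bar>?h y\<bar>)\<^sup>2" by simp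
    then show "\<bar>g y * ?h y\<bar> \<le> ((g y)\<^sup>2 + (?h y)\<^sup>2) / 2"
      by (simp add: power2_diff abs_mult)
  qed
  moreover have "(\<Sum>y\<in>cube d. ((g y)\<^sup>2 + (?h y)\<^sup>2) / 2) = (\<Sum>y\<in>cube d. (g y)\<^sup>2)"
    using sum_cube_cmul[OF x, of "\<lambda>y. (g y)\<^sup>2"]
    by (simp add: sum.distrib flip: sum_divide_distrib)
  ultimately have "\<bar>\<Sum>y\<in>cube d. f y * ?h y\<bar> \<le> (\<Sum>y\<in>cube d. (g y)\<^sup>2) / 2"
    by linarith
  then show ?thesis
    unfolding 1 influence_def cube_expect_def g_def
    by (simp add: abs_divide divide_right_mono flip: sum_divide_distrib)
       (simp add: field_simps)
qed

section \<open>The law of one row of edges\<close>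

definition bern :: "real \<Rightarrow> bool \<Rightarrow> real" where
  "bern s b = (if b then s else 1 - s)"

lemma bern_nonneg: "0 \<le> s \<Longrightarrow> s \<le> 1 \<Longrightarrow> 0 \<le> bern s b"
  and bern_pos: "0 < s \<Longrightarrow> s < 1 \<Longrightarrow> 0 < bern s b"
  by (auto simp: bern_def)

text \<open>Expanding the product on the right picks one summand for each \<open>j\<close>;
  \<open>R\<close> records where \<open>True\<close> is picked.\<close>

lemma sum_Pow_prod:
  fixes F :: "'a \<Rightarrow> bool \<Rightarrow> 'b :: comm_semiring_1"
  assumes "finite A"
  shows "(\<Sum>R\<in>Pow A. \<Prod>j\<in>A. F j (j \<in> R)) = (\<Prod>j\<in>A. F j True + F j False)"
proof -
  have "(\<Prod>j\<in>A. F j (j \<in> R)) = (\<Prod>j\<in>R. F j True) * (\<Prod>j\<in>A - R. F j False)" if "R \<subseteq> A" for R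
    using prod.subset_diff[OF that assms, of "\<lambda>j. F j (j \<in> R)"] that
    by (simp add: mult.commute)
  then show ?thesis
    by (simp add: prod_add[OF assms])
qed

lemma sum_Pow_bern:
  assumes "finite A"
  shows "(\<Sum>R\<in>Pow A. \<Prod>j\<in>A. bern (s j) (j \<in> R)) = 1"
  using sum_Pow_prod[OF assms, of "\<lambda>j. bern (s j)"] by (simp add: bern_def)

definition row_lik :: "nat \<Rightarrow> (int list \<Rightarrow> real) \<Rightarrow> (nat \<Rightarrow> int list) \<Rightarrow> int list \<Rightarrow> nat set \<Rightarrow> real" where
  "row_lik n \<sigma> X x R = (\<Prod>i<n. bern (\<sigma> (cmul (X i) x)) (i \<in> R))"

definition row_gnp :: "nat \<Rightarrow> real \<Rightarrow> nat set \<Rightarrow> real" where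
  "row_gnp n p R = (\<Prod>i<n. bern p (i \<in> R))"

text \<open>The likelihood ratio of Bernoulli \<open>s\<close> to Bernoulli \<open>p\<close> is 1
  plus \<open>s - p\<close> times a centred variable of variance \<open>1 / (p * (1 - p))\<close>.
  This is the inner product of two such ratios under Bernoulli \<open>p\<close>.\<close>

lemma bern_product_identity:
  assumes "0 < p" "p < 1"
  shows "bern s True * bern t True / bern p True + bern s False * bern t False / bern p False
    = 1 + (s - p) * (t - p) / (p * (1 - p))"
  using assms by (simp add: bern_def divide_simps) (simp add: algebra_simps)

text \<open>Squaring the average over the new latent vector introduces two independent replicas
  \<open>x\<close> and \<open>y\<close>. For fixed replicas the sum over rows factors over old
  vertices, and averaging over their independent vectors makes all \<open>n\<close> factors equal.
  They depend only on \<open>cmul x y\<close>, which is uniform, so one expectation remains.\<close>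

lemma row_chi_square:
  assumes p: "0 < p" "p < 1"
  shows "(\<Sum>X\<in>PiE {..<n} (\<lambda>_. cube d). 1 / 2 ^ (d * n) *
      (\<Sum>R\<in>Pow {..<n}. (cube_expect d (\<lambda>x. row_lik n \<sigma> X x R))\<^sup>2 / row_gnp n p R))
    = cube_expect d (\<lambda>x. (1 + autocorr d (\<lambda>y. \<sigma> y - p) x / (p * (1 - p))) ^ n)"
proof -
  define N :: real where "N = 2 ^ d"
  have N: "N > 0" by (simp add: N_def)
  have Nn: "2 ^ (d * n) = N ^ n" by (simp add: N_def power_mult)
  define K where "K = (\<lambda>z x y. 1 + (\<sigma> (cmul z x) - p) * (\<sigma> (cmul z y) - p) / (p * (1 - p)))"
  define \<gamma> where "\<gamma> = autocorr d (\<lambda>y. \<sigma> y - p)"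
  have row: "(\<Sum>R\<in>Pow {..<n}. (cube_expect d (\<lambda>x. row_lik n \<sigma> X x R))\<^sup>2 / row_gnp n p R)
      = (\<Sum>x\<in>cube d. \<Sum>y\<in>cube d. \<Prod>j<n. K (X j) x y) / N\<^sup>2" for X
  proof -
    let ?F = "\<lambda>x y j b. bern (\<sigma> (cmul (X j) x)) b * bern (\<sigma> (cmul (X j) y)) b / bern p b"
    have "(cube_expect d (\<lambda>x. row_lik n \<sigma> X x R))\<^sup>2 / row_gnp n p R
        = (\<Sum>x\<in>cube d. \<Sum>y\<in>cube d. \<Prod>j<n. ?F x y j (j \<in> R)) / N\<^sup>2" for R
    proof -
      have "(cube_expect d (\<lambda>x. row_lik n \<sigma> X x R))\<^sup>2
          = (\<Sum>x\<in>cube d. \<Sum>y\<in>cube d. row_lik n \<sigma> X x R * row_lik n \<sigma> X y R) / N\<^sup>2"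
        by (simp add: cube_expect_def N_def power_divide power2_eq_square sum_product)
      then show ?thesis
        by (simp add: row_lik_def row_gnp_def prod.distrib prod_dividef sum_divide_distrib mult.commute[of "N\<^sup>2"])
    qed
    then have "(\<Sum>R\<in>Pow {..<n}. (cube_expect d (\<lambda>x. row_lik n \<sigma> X x R))\<^sup>2 / row_gnp n p R)
        = (\<Sum>R\<in>Pow {..<n}. \<Sum>x\<in>cube d. \<Sum>y\<in>cube d. \<Prod>j<n. ?F x y j (j \<in> R)) / N\<^sup>2"
      by (simp add: sum_divide_distrib)
    also have "(\<Sum>R\<in>Pow {..<n}. \<Sum>x\<in>cube d. \<Sum>y\<in>cube d. \<Prod>j<n. ?F x y j (j \<in> R))
        = (\<Sum>x\<in>cube d. \<Sum>R\<in>Pow {..<n}. \<Sum>y\<in>cube d. \<Prod>j<n. ?F x y j (j \<in> R))"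
      by (rule sum.swap)
    also have "\<dots> = (\<Sum>x\<in>cube d. \<Sum>y\<in>cube d. \<Sum>R\<in>Pow {..<n}. \<Prod>j<n. ?F x y j (j \<in> R))"
      by (intro sum.cong refl sum.swap)
    also have "\<dots> = (\<Sum>x\<in>cube d. \<Sum>y\<in>cube d. \<Prod>j<n. K (X j) x y)"
      using sum_Pow_prod[of "{..<n}" "?F x y" for x y]
      by (simp only: finite_lessThan bern_product_identity[OF p] K_def simp_thms)
    finally show ?thesis .
  qed
  have KK: "(\<Sum>z\<in>cube d. K z x y) = N * (1 + \<gamma> (cmul x y) / (p * (1 - p)))"
    if xy: "x \<in> cube d" "y \<in> cube d" for x y
  proof -
    \<comment> \<open>Substituting \<open>cmul x z\<close> for \<open>z\<close> cancels
      \<open>x\<close> in the first factor and leaves the shift \<open>cmul x y\<close> in the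
      second.\<close>
    have "(\<Sum>z\<in>cube d. (\<sigma> (cmul z x) - p) * (\<sigma> (cmul z y) - p))
        = (\<Sum>z\<in>cube d. (\<sigma> (cmul x (cmul x z)) - p) * (\<sigma> (cmul (cmul x z) y) - p))"
      using sum_cube_cmul[OF xy(1), of "\<lambda>z. (\<sigma> (cmul z x) - p) * (\<sigma> (cmul z y) - p)"]
      by (simp add: cmul_commute[of _ x])
    also have "\<dots> = (\<Sum>z\<in>cube d. (\<sigma> z - p) * (\<sigma> (cmul (cmul x y) z) - p))"
    proof (rule sum.cong)
      fix z assume z: "z \<in> cube d"
      have "cmul (cmul x z) y = cmul (cmul x y) z"
        by (metis cmul_assoc cmul_commute)
      then show "(\<sigma> (cmul x (cmul x z)) - p) * (\<sigma> (cmul (cmul x z) y) - p)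
          = (\<sigma> z - p) * (\<sigma> (cmul (cmul x y) z) - p)"
        using cmul_cancel[OF xy(1) z] by simp
    qed simp
    also have "\<dots> = N * \<gamma> (cmul x y)"
      by (simp add: \<gamma>_def autocorr_def cube_expect_def N_def)
    finally have "(\<Sum>z\<in>cube d. (\<sigma> (cmul z x) - p) * (\<sigma> (cmul z y) - p)) = N * \<gamma> (cmul x y)" .
    then show ?thesis
      by (simp add: K_def sum.distrib distrib_left N_def flip: sum_divide_distrib)
  qed
  have PK: "(\<Sum>X\<in>PiE {..<n} (\<lambda>_. cube d). \<Prod>j<n. K (X j) x y)
      = N ^ n * (1 + \<gamma> (cmul x y) / (p * (1 - p))) ^ n" if "x \<in> cube d" "y \<in> cube d" for x y
  proof -
    have "(\<Sum>X\<in>PiE {..<n} (\<lambda>_. cube d). \<Prod>j<n. K (X j) x y) = (\<Prod>j<n. \<Sum>z\<in>cube d. K z x y)"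
      by (rule prod_sum_PiE[symmetric]) auto
    then show ?thesis by (simp add: KK that power_mult_distrib)
  qed
  have "(\<Sum>X\<in>PiE {..<n} (\<lambda>_. cube d). 1 / 2 ^ (d * n) *
      (\<Sum>R\<in>Pow {..<n}. (cube_expect d (\<lambda>x. row_lik n \<sigma> X x R))\<^sup>2 / row_gnp n p R))
    = (\<Sum>X\<in>PiE {..<n} (\<lambda>_. cube d). \<Sum>x\<in>cube d. \<Sum>y\<in>cube d. \<Prod>j<n. K (X j) x y) / (N ^ n * N\<^sup>2)"
    by (simp add: row Nn flip: sum_divide_distrib)
  also have "(\<Sum>X\<in>PiE {..<n} (\<lambda>_. cube d). \<Sum>x\<in>cube d. \<Sum>y\<in>cube d. \<Prod>j<n. K (X j) x y)
    = (\<Sum>x\<in>cube d. \<Sum>X\<in>PiE {..<n} (\<lambda>_. cube d). \<Sum>y\<in>cube d. \<Prod>j<n. K (X j) x y)"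
    by (rule sum.swap)
  also have "\<dots> = (\<Sum>x\<in>cube d. \<Sum>y\<in>cube d. \<Sum>X\<in>PiE {..<n} (\<lambda>_. cube d). \<Prod>j<n. K (X j) x y)"
    by (intro sum.cong refl sum.swap)
  also have "\<dots> = (\<Sum>x\<in>cube d. \<Sum>y\<in>cube d. N ^ n * (1 + \<gamma> (cmul x y) / (p * (1 - p))) ^ n)"
    by (simp add: PK)
  also have "\<dots> = (\<Sum>x\<in>cube d. \<Sum>y\<in>cube d. N ^ n * (1 + \<gamma> y / (p * (1 - p))) ^ n)"
    by (intro sum.cong refl sum_cube_cmul)
  also have "\<dots> = N ^ n * N * (\<Sum>y\<in>cube d. (1 + \<gamma> y / (p * (1 - p))) ^ n)"
    by (simp add: N_def sum_distrib_left mult_ac)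
  finally show ?thesis
    using N by (simp add: \<gamma>_def cube_expect_def N_def power2_eq_square)
qed

text \<open>By \<open>bern_product_identity\<close> this is an average of nonnegative terms. The
  sign is what permits raising \<open>1 + u \<le> exp u\<close> to the power
  \<open>n\<close>.\<close>

lemma autocorr_lower:
  assumes p: "0 < p" "p < 1"
    and \<sigma>: "\<forall>x\<in>cube d. 0 \<le> \<sigma> x \<and> \<sigma> x \<le> 1" and x: "x \<in> cube d"
  shows "0 \<le> 1 + autocorr d (\<lambda>y. \<sigma> y - p) x / (p * (1 - p))"
proof -
  have "1 + autocorr d (\<lambda>y. \<sigma> y - p) x / (p * (1 - p))
      = cube_expect d (\<lambda>y. 1 + (\<sigma> y - p) * (\<sigma> (cmul x y) - p) / (p * (1 - p)))"
    by (simp add: autocorr_def cube_expect_def sum.distrib add_divide_distrib flip: sum_divide_distrib)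
  also have "\<dots> \<ge> 0"
    unfolding cube_expect_def bern_product_identity[OF p, symmetric]
    using \<sigma> x p by (intro divide_nonneg_pos sum_nonneg add_nonneg_nonneg mult_nonneg_nonneg bern_nonneg bern_pos) auto
  finally show ?thesis .
qed

text \<open>After \<open>1 + u \<le> exp u\<close>, the bounded-differences estimate applies with
  \<open>c i = L * influence d \<sigma> i\<close>. Centring \<sigma> leaves its influences unchanged
  and makes the mean of the autocorrelation vanish.\<close>

lemma autocorr_moment_le:
  assumes p: "0 < p" "p < 1" and mean: "cube_expect d \<sigma> = p"
    and \<sigma>: "\<forall>x\<in>cube d. 0 \<le> \<sigma> x \<and> \<sigma> x \<le> 1"
  shows "cube_expect d (\<lambda>x. (1 + autocorr d (\<lambda>y. \<sigma> y - p) x / (p * (1 - p))) ^ n)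
    \<le> exp ((real n)\<^sup>2 * (\<Sum>i<d. (influence d \<sigma> i)\<^sup>2) / (p\<^sup>2 * (1 - p)\<^sup>2) / 2)"
proof -
  define f where "f = (\<lambda>y. \<sigma> y - p)"
  define L where "L = real n / (p * (1 - p))"
  have L: "L \<ge> 0" using p by (simp add: L_def)
  have inf: "influence d f i = influence d \<sigma> i" for i
    by (simp add: influence_def f_def)
  have mean0: "cube_expect d f = 0"
    using mean by (simp add: f_def cube_expect_def sum_subtractf diff_divide_distrib)
  have "cube_expect d (\<lambda>x. (1 + autocorr d f x / (p * (1 - p))) ^ n)
      \<le> cube_expect d (\<lambda>x. exp (L * autocorr d f x))"
    unfolding cube_expect_def
  proof (intro divide_right_mono sum_mono)
    fix x assume x: "x \<in> cube d"
    let ?u = "autocorr d f x / (p * (1 - p))"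
    have "(1 + ?u) ^ n \<le> exp ?u ^ n"
      using autocorr_lower[OF p \<sigma> x] exp_ge_add_one_self[of ?u]
      by (intro power_mono) (auto simp: f_def)
    also have "\<dots> = exp (L * autocorr d f x)"
      by (simp add: L_def flip: exp_of_nat_mult)
    finally show "(1 + ?u) ^ n \<le> exp (L * autocorr d f x)" .
  qed simp
  also have "\<dots> \<le> exp (cube_expect d (\<lambda>x. L * autocorr d f x) + (\<Sum>i<d. (L * influence d \<sigma> i)\<^sup>2) / 2)"
  proof (rule cube_expect_exp_le)
    fix i x assume "i < d" "x \<in> cube d"
    then have "L * \<bar>autocorr d f x - autocorr d f (flip i x)\<bar> \<le> L * (2 * influence d \<sigma> i)"
      using autocorr_flip_le[of i d x f] L by (intro mult_left_mono) (auto simp: inf)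
    then show "\<bar>L * autocorr d f x - L * autocorr d f (flip i x)\<bar> \<le> 2 * (L * influence d \<sigma> i)"
      using L by (simp add: abs_mult mult_ac flip: right_diff_distrib)
  qed
  also have "cube_expect d (\<lambda>x. L * autocorr d f x) = L * cube_expect d (autocorr d f)"
    by (simp add: cube_expect_def sum_distrib_left)
  also have "(\<Sum>i<d. (L * influence d \<sigma> i)\<^sup>2) = L\<^sup>2 * (\<Sum>i<d. (influence d \<sigma> i)\<^sup>2)"
    by (simp add: power_mult_distrib sum_distrib_left)
  finally show ?thesis
    unfolding cube_expect_autocorr mean0
    by (simp add: f_def L_def power_divide power_mult_distrib)
qed

section \<open>Revealing the graph vertex by vertex\<close>

lemma finite_vpairs [simp]: "finite (vpairs n)"
proof (rule finite_subset)
  show "vpairs n \<subseteq> {..<n} \<times> {..<n}" by (auto simp: vpairs_def)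
qed simp

lemma vpairs_Suc: "vpairs (Suc n) = vpairs n \<union> (\<lambda>i. (i, n)) ` {..<n}"
  by (auto simp: vpairs_def less_Suc_eq)

lemma prod_vpairs_Suc:
  "(\<Prod>e\<in>vpairs (Suc n). F e) = (\<Prod>e\<in>vpairs n. F e) * (\<Prod>i<n. F (i, n))"
  for F :: "nat \<times> nat \<Rightarrow> 'a :: comm_monoid_mult"
proof -
  have "vpairs n \<inter> (\<lambda>i. (i, n)) ` {..<n} = {}" by (auto simp: vpairs_def)
  then show ?thesis
    unfolding vpairs_Suc by (subst prod.union_disjoint) (auto simp: prod.reindex inj_on_def)
qed

text \<open>Pairs carry the smaller vertex first, so the edges from the new vertex \<open>n\<close>
  back to older ones are the pairs \<open>(i, n)\<close>.\<close>

definition add_row :: "nat \<Rightarrow> (nat \<times> nat) set \<Rightarrow> nat set \<Rightarrow> (nat \<times> nat) set" where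
  "add_row n E R = E \<union> (\<lambda>i. (i, n)) ` R"

lemma bij_betw_add_row:
  "bij_betw (\<lambda>(E, R). add_row n E R) (Pow (vpairs n) \<times> Pow {..<n}) (Pow (vpairs (Suc n)))"
proof (rule bij_betw_byWitness[where f' = "\<lambda>E. (E \<inter> vpairs n, {i. (i, n) \<in> E})"])
  show "\<forall>a\<in>Pow (vpairs n) \<times> Pow {..<n}.
      (\<lambda>E. (E \<inter> vpairs n, {i. (i, n) \<in> E})) ((\<lambda>(E, R). add_row n E R) a) = a"
    by (auto simp: add_row_def vpairs_def)
  show "\<forall>E\<in>Pow (vpairs (Suc n)). (\<lambda>(E, R). add_row n E R) (E \<inter> vpairs n, {i. (i, n) \<in> E}) = E"
    by (auto simp: add_row_def vpairs_Suc)
  show "(\<lambda>(E, R). add_row n E R) ` (Pow (vpairs n) \<times> Pow {..<n}) \<subseteq> Pow (vpairs (Suc n))"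
    by (auto simp: add_row_def vpairs_Suc)
  show "(\<lambda>E. (E \<inter> vpairs n, {i. (i, n) \<in> E})) ` Pow (vpairs (Suc n)) \<subseteq> Pow (vpairs n) \<times> Pow {..<n}"
    by (auto simp: vpairs_def less_Suc_eq)
qed

lemma prod_add_row:
  fixes F :: "nat \<times> nat \<Rightarrow> bool \<Rightarrow> 'a :: comm_monoid_mult"
  assumes "E \<subseteq> vpairs n"
  shows "(\<Prod>e\<in>vpairs (Suc n). F e (e \<in> add_row n E R))
    = (\<Prod>e\<in>vpairs n. F e (e \<in> E)) * (\<Prod>i<n. F (i, n) (i \<in> R))"
  unfolding prod_vpairs_Suc
proof (intro arg_cong2[of _ _ _ _ "(*)"] prod.cong refl)
  fix e assume "e \<in> vpairs n"
  then show "F e (e \<in> add_row n E R) = F e (e \<in> E)"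
    by (intro arg_cong[of _ _ "F e"]) (auto simp: add_row_def vpairs_def)
next
  fix i
  show "F (i, n) ((i, n) \<in> add_row n E R) = F (i, n) (i \<in> R)"
    using assms by (intro arg_cong[of _ _ "F (i, n)"]) (auto simp: add_row_def vpairs_def)
qed

definition graph_lik :: "nat \<Rightarrow> (int list \<Rightarrow> real) \<Rightarrow> (nat \<Rightarrow> int list) \<Rightarrow> (nat \<times> nat) set \<Rightarrow> real" where
  "graph_lik n \<sigma> X E = (\<Prod>e\<in>vpairs n. bern (\<sigma> (cmul (X (fst e)) (X (snd e)))) (e \<in> E))"

lemma rag_prob_eq:
  "rag_prob n d \<sigma> E = (\<Sum>X\<in>PiE {..<n} (\<lambda>_. cube d). 1 / 2 ^ (d * n) * graph_lik n \<sigma> X E)"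
  by (simp add: rag_prob_def graph_lik_def bern_def split_def sum_divide_distrib)

lemma gnp_prob_eq: "gnp_prob n p E = (\<Prod>e\<in>vpairs n. bern p (e \<in> E))"
  by (simp add: gnp_prob_def bern_def split_def)

lemma gnp_prob_add_row:
  "E \<subseteq> vpairs n \<Longrightarrow> gnp_prob (Suc n) p (add_row n E R) = gnp_prob n p E * row_gnp n p R"
  unfolding gnp_prob_eq row_gnp_def by (rule prod_add_row)

lemma graph_lik_add_row:
  assumes "E \<subseteq> vpairs n"
  shows "graph_lik (Suc n) \<sigma> (X(n := x)) (add_row n E R) = graph_lik n \<sigma> X E * row_lik n \<sigma> X x R"
proof -
  \<comment> \<open>No pair in \<open>vpairs n\<close> involves vertex \<open>n\<close>, so its
    latent vector does not affect the old graph.\<close>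
  have "graph_lik n \<sigma> (X(n := x)) E = graph_lik n \<sigma> X E"
    unfolding graph_lik_def by (intro prod.cong refl) (auto simp: vpairs_def)
  then show ?thesis
    unfolding graph_lik_def row_lik_def
    using prod_add_row[OF assms, where F = "\<lambda>e. bern (\<sigma> (cmul ((X(n := x)) (fst e)) ((X(n := x)) (snd e))))"]
    by simp
qed

text \<open>Given the old latent vectors, the old graph and the new row are independent, and
  averaging over the new vector affects only the row. This is the mixture form \<open>J\<close> of
  \<open>kl_div_mixture_step\<close>.\<close>

lemma rag_prob_add_row:
  assumes "E \<subseteq> vpairs n"
  shows "rag_prob (Suc n) d \<sigma> (add_row n E R) = (\<Sum>X\<in>PiE {..<n} (\<lambda>_. cube d).
    1 / 2 ^ (d * n) * graph_lik n \<sigma> X E * cube_expect d (\<lambda>x. row_lik n \<sigma> X x R))"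
proof -
  have "rag_prob (Suc n) d \<sigma> (add_row n E R) = (\<Sum>X\<in>(\<lambda>(x, X). X(n := x)) ` (cube d \<times> PiE {..<n} (\<lambda>_. cube d)).
      1 / 2 ^ (d * Suc n) * graph_lik (Suc n) \<sigma> X (add_row n E R))"
    unfolding rag_prob_eq lessThan_Suc PiE_insert_eq ..
  also have "\<dots> = (\<Sum>(x, X)\<in>cube d \<times> PiE {..<n} (\<lambda>_. cube d).
      1 / 2 ^ (d * Suc n) * graph_lik (Suc n) \<sigma> (X(n := x)) (add_row n E R))"
    by (subst sum.reindex[OF inj_combinator]) (auto simp: split_def)
  also have "\<dots> = (\<Sum>x\<in>cube d. \<Sum>X\<in>PiE {..<n} (\<lambda>_. cube d).
      1 / 2 ^ (d * Suc n) * (graph_lik n \<sigma> X E * row_lik n \<sigma> X x R))"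
    by (simp add: sum.cartesian_product[symmetric] graph_lik_add_row[OF assms])
  also have "\<dots> = (\<Sum>X\<in>PiE {..<n} (\<lambda>_. cube d). \<Sum>x\<in>cube d.
      1 / 2 ^ (d * Suc n) * (graph_lik n \<sigma> X E * row_lik n \<sigma> X x R))"
    by (rule sum.swap)
  finally show ?thesis
    by (simp add: cube_expect_def sum_distrib_left sum_divide_distrib power_add mult_ac)
qed

section \<open>Normalisation and positivity of the laws\<close>

lemma sum_graph_lik: "(\<Sum>E\<in>Pow (vpairs n). graph_lik n \<sigma> X E) = 1"
  by (simp add: graph_lik_def sum_Pow_bern)

lemma sum_gnp_prob: "(\<Sum>E\<in>Pow (vpairs n). gnp_prob n p E) = 1"
  by (simp add: gnp_prob_eq sum_Pow_bern)

lemma sum_row_lik: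
  "(\<Sum>R\<in>Pow {..<n}. cube_expect d (\<lambda>x. row_lik n \<sigma> X x R)) = 1"
proof -
  have "(\<Sum>R\<in>Pow {..<n}. cube_expect d (\<lambda>x. row_lik n \<sigma> X x R))
      = (\<Sum>x\<in>cube d. \<Sum>R\<in>Pow {..<n}. row_lik n \<sigma> X x R) / 2 ^ d"
    unfolding cube_expect_def sum_divide_distrib[symmetric] by (subst sum.swap) simp
  then show ?thesis
    by (simp add: row_lik_def sum_Pow_bern)
qed

lemma sum_uniform_latent:
  "(\<Sum>X\<in>PiE {..<n} (\<lambda>_. cube d). 1 / 2 ^ (d * n) :: real) = 1"
  by (simp add: card_PiE power_mult)

lemma sum_rag_prob: "(\<Sum>E\<in>Pow (vpairs n). rag_prob n d \<sigma> E) = 1"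
  unfolding rag_prob_eq
  by (subst sum.swap) (simp only: sum_distrib_left[symmetric] sum_graph_lik mult_1_right sum_uniform_latent)

lemma graph_lik_nonneg:
  assumes "\<forall>x\<in>cube d. 0 \<le> \<sigma> x \<and> \<sigma> x \<le> 1" "X \<in> PiE {..<n} (\<lambda>_. cube d)"
  shows "0 \<le> graph_lik n \<sigma> X E"
  unfolding graph_lik_def
proof (intro prod_nonneg bern_nonneg)
  fix e assume "e \<in> vpairs n"
  then have "cmul (X (fst e)) (X (snd e)) \<in> cube d"
    using assms(2) by (intro cmul_in_cube) (auto simp: vpairs_def PiE_def Pi_def)
  then show "0 \<le> \<sigma> (cmul (X (fst e)) (X (snd e)))" "\<sigma> (cmul (X (fst e)) (X (snd e))) \<le> 1"
    using assms(1) by auto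
qed

lemma row_lik_nonneg:
  assumes "\<forall>x\<in>cube d. 0 \<le> \<sigma> x \<and> \<sigma> x \<le> 1" "X \<in> PiE {..<n} (\<lambda>_. cube d)" "x \<in> cube d"
  shows "0 \<le> row_lik n \<sigma> X x R"
  unfolding row_lik_def
proof (intro prod_nonneg bern_nonneg)
  fix i assume "i \<in> {..<n}"
  then have "cmul (X i) x \<in> cube d"
    using assms(2,3) by (intro cmul_in_cube) (auto simp: PiE_def Pi_def)
  then show "0 \<le> \<sigma> (cmul (X i) x)" "\<sigma> (cmul (X i) x) \<le> 1"
    using assms(1) by auto
qed

lemma gnp_prob_pos: "0 < p \<Longrightarrow> p < 1 \<Longrightarrow> 0 < gnp_prob n p E"
  unfolding gnp_prob_eq by (intro prod_pos ballI bern_pos)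

lemma row_gnp_pos: "0 < p \<Longrightarrow> p < 1 \<Longrightarrow> 0 < row_gnp n p R"
  unfolding row_gnp_def by (intro prod_pos ballI bern_pos)

lemma rag_prob_nonneg:
  assumes "\<forall>x\<in>cube d. 0 \<le> \<sigma> x \<and> \<sigma> x \<le> 1"
  shows "0 \<le> rag_prob n d \<sigma> E"
  unfolding rag_prob_eq by (intro sum_nonneg mult_nonneg_nonneg graph_lik_nonneg[OF assms]) auto

text \<open>An instance of \<open>kl_div_mixture_step\<close>: the old graph is \<open>g\<close>,
  the new row is \<open>t\<close>, and the old latent vectors are \<open>X\<close>. The reference
  law factors by \<open>gnp_prob_add_row\<close>, and \<open>row_chi_square\<close> evaluates the
  added term.\<close>

lemma kl_div_rag_Suc:
  assumes p: "0 < p" "p < 1" and \<sigma>: "\<forall>x\<in>cube d. 0 \<le> \<sigma> x \<and> \<sigma> x \<le> 1"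
  shows "kl_div (Pow (vpairs (Suc n))) (rag_prob (Suc n) d \<sigma>) (gnp_prob (Suc n) p)
    \<le> kl_div (Pow (vpairs n)) (rag_prob n d \<sigma>) (gnp_prob n p)
      + cube_expect d (\<lambda>x. (1 + autocorr d (\<lambda>y. \<sigma> y - p) x / (p * (1 - p))) ^ n) - 1"
proof -
  let ?S = "PiE {..<n} (\<lambda>_. cube d)"
  let ?\<mu> = "\<lambda>X :: nat \<Rightarrow> int list. 1 / 2 ^ (d * n) :: real"
  let ?r = "\<lambda>R X. cube_expect d (\<lambda>x. row_lik n \<sigma> X x R)"
  let ?J = "\<lambda>(E, R). \<Sum>X\<in>?S. ?\<mu> X * graph_lik n \<sigma> X E * ?r R X"
  have r0: "0 \<le> ?r R X" if "X \<in> ?S" for R X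
    unfolding cube_expect_def
    by (intro divide_nonneg_pos sum_nonneg row_lik_nonneg[OF \<sigma> that]) auto
  have "kl_div (Pow (vpairs (Suc n))) (rag_prob (Suc n) d \<sigma>) (gnp_prob (Suc n) p)
      = (\<Sum>(E, R)\<in>Pow (vpairs n) \<times> Pow {..<n}. rag_prob (Suc n) d \<sigma> (add_row n E R) *
          ln (rag_prob (Suc n) d \<sigma> (add_row n E R) / gnp_prob (Suc n) p (add_row n E R)))"
    unfolding kl_div_def
    by (subst sum.reindex_bij_betw[OF bij_betw_add_row, symmetric]) (simp add: split_def)
  also have "\<dots> = kl_div (Pow (vpairs n) \<times> Pow {..<n}) ?J (\<lambda>(E, R). gnp_prob n p E * row_gnp n p R)"
    unfolding kl_div_def
    by (intro sum.cong) (auto simp: rag_prob_add_row gnp_prob_add_row)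
  also have "\<dots> \<le> kl_div (Pow (vpairs n)) (\<lambda>E. \<Sum>X\<in>?S. ?\<mu> X * graph_lik n \<sigma> X E) (gnp_prob n p)
      + (\<Sum>X\<in>?S. ?\<mu> X * (\<Sum>R\<in>Pow {..<n}. (?r R X)\<^sup>2 / row_gnp n p R)) - 1"
    by (rule kl_div_mixture_step[where W = "\<lambda>E X. graph_lik n \<sigma> X E" and r = ?r])
      (auto intro!: graph_lik_nonneg[OF \<sigma>] r0 gnp_prob_pos row_gnp_pos p
        simp: sum_graph_lik sum_row_lik sum_uniform_latent simp del: sum_constant)
  finally show ?thesis
    unfolding row_chi_square[OF p] rag_prob_eq .
qed

lemma kl_div_rag_le:
  assumes p: "0 < p" "p < 1" and mean: "cube_expect d \<sigma> = p"
    and \<sigma>: "\<forall>x\<in>cube d. 0 \<le> \<sigma> x \<and> \<sigma> x \<le> 1"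
  shows "kl_div (Pow (vpairs n)) (rag_prob n d \<sigma>) (gnp_prob n p)
    \<le> (\<Sum>k<n. exp ((real k)\<^sup>2 * (\<Sum>i<d. (influence d \<sigma> i)\<^sup>2) / (p\<^sup>2 * (1 - p)\<^sup>2) / 2) - 1)"
proof (induction n)
  case 0
  \<comment> \<open>With no vertices both laws give mass 1 to the empty graph, so the divergence
    starts at 0.\<close>
  have "vpairs 0 = {}" by (auto simp: vpairs_def)
  then show ?case by (simp add: kl_div_def rag_prob_def gnp_prob_def)
next
  case (Suc n)
  then show ?case
    using kl_div_rag_Suc[OF p \<sigma>, of n] autocorr_moment_le[OF p mean \<sigma>, of n] by simp
qed

section \<open>From divergence to total variation\<close>

lemma tv_rag_gnp_le_one:
  assumes "0 < p" "p < 1" and "\<forall>x\<in>cube d. 0 \<le> \<sigma> x \<and> \<sigma> x \<le> 1"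
  shows "tv_rag_gnp n d \<sigma> p \<le> 1" "0 \<le> tv_rag_gnp n d \<sigma> p"
proof -
  have "(\<Sum>E\<in>Pow (vpairs n). \<bar>rag_prob n d \<sigma> E - gnp_prob n p E\<bar>)
      \<le> (\<Sum>E\<in>Pow (vpairs n). rag_prob n d \<sigma> E + gnp_prob n p E)"
  proof (rule sum_mono)
    fix E
    show "\<bar>rag_prob n d \<sigma> E - gnp_prob n p E\<bar> \<le> rag_prob n d \<sigma> E + gnp_prob n p E"
      using rag_prob_nonneg[OF assms(3), of n E] gnp_prob_pos[OF assms(1,2), of n E] by linarith
  qed
  then show "tv_rag_gnp n d \<sigma> p \<le> 1"
    by (simp add: tv_rag_gnp_def sum.distrib sum_rag_prob sum_gnp_prob)
  show "0 \<le> tv_rag_gnp n d \<sigma> p"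
    by (simp add: tv_rag_gnp_def sum_nonneg)
qed

lemma tv_rag_gnp_sq_le:
  assumes p: "0 < p" "p < 1" and mean: "cube_expect d \<sigma> = p"
    and \<sigma>: "\<forall>x\<in>cube d. 0 \<le> \<sigma> x \<and> \<sigma> x \<le> 1"
  shows "(tv_rag_gnp n d \<sigma> p)\<^sup>2
    \<le> real n ^ 3 * (\<Sum>i<d. (influence d \<sigma> i)\<^sup>2) / (p\<^sup>2 * (1 - p)\<^sup>2)"
proof -
  define v where "v = (\<Sum>i<d. (influence d \<sigma> i)\<^sup>2) / (p\<^sup>2 * (1 - p)\<^sup>2)"
  have v: "v \<ge> 0" unfolding v_def by (intro divide_nonneg_nonneg sum_nonneg) auto
  have "(tv_rag_gnp n d \<sigma> p)\<^sup>2 \<le> real n ^ 3 * v"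
  proof (cases "(real n)\<^sup>2 * v \<le> 1")
    case True
    have "(tv_rag_gnp n d \<sigma> p)\<^sup>2 \<le> kl_div (Pow (vpairs n)) (rag_prob n d \<sigma>) (gnp_prob n p)"
      unfolding tv_rag_gnp_def
      by (intro tv_sq_le_kl_div rag_prob_nonneg[OF \<sigma>] gnp_prob_pos p sum_rag_prob sum_gnp_prob)
    also have "\<dots> \<le> (\<Sum>k<n. exp ((real k)\<^sup>2 * v / 2) - 1)"
      using kl_div_rag_le[OF p mean \<sigma>, of n] by (simp add: v_def)
    also have "\<dots> \<le> (\<Sum>k<n. (real n)\<^sup>2 * v)"
    proof (rule sum_mono)
      fix k assume "k \<in> {..<n}"
      then have k: "(real k)\<^sup>2 * v \<le> (real n)\<^sup>2 * v"
        using v by (intro mult_right_mono power_mono) auto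
      define a where "a = (real k)\<^sup>2 * v / 2"
      have a: "0 \<le> a" "a \<le> 1" using k True v by (auto simp: a_def)
      \<comment> \<open>On the unit interval this yields \<open>exp a - 1 \<le> 2 * a\<close>. The 2
        cancels the half in the exponent, which is why the implied constant can be 1.\<close>
      have "exp a \<le> 1 + a + a\<^sup>2" using a by (intro exp_bound) auto
      also have "a\<^sup>2 \<le> a" using a by (simp add: power2_eq_square mult_left_le)
      finally have "exp a - 1 \<le> 2 * a" by simp
      then show "exp ((real k)\<^sup>2 * v / 2) - 1 \<le> (real n)\<^sup>2 * v"
        using k by (simp add: a_def)
    qed
    finally show ?thesis by (simp add: power3_eq_cube power2_eq_square mult_ac)
  next
    case False
    \<comment> \<open>For \<open>n = 0\<close> the failed condition would read \<open>0 > 1\<close>;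
      with \<open>n \<ge> 1\<close> the right side exceeds 1.\<close>
    then have n: "real n \<ge> 1" by (cases n) auto
    have "(tv_rag_gnp n d \<sigma> p)\<^sup>2 \<le> 1"
      using tv_rag_gnp_le_one[OF p \<sigma>, of n] by (intro power_le_one) auto
    also have "1 \<le> 1 * ((real n)\<^sup>2 * v)" using False by simp
    also have "\<dots> \<le> real n * ((real n)\<^sup>2 * v)" using n v by (intro mult_right_mono) auto
    finally show ?thesis by (simp add: power3_eq_cube power2_eq_square mult_ac)
  qed
  then show ?thesis by (simp add: v_def)
qed

theorem theorem1p11:
  shows "\<exists>C::real. \<forall>(n::nat) (d::nat) (\<sigma>::int list \<Rightarrow> real) (p::real).
    (\<forall>x\<in>cube d. 0 \<le> \<sigma> x \<and> \<sigma> x \<le> 1) \<longrightarrow>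
    (\<forall>x\<in>cube d. \<sigma> x = \<sigma> (cneg x)) \<longrightarrow>
    cube_expect d \<sigma> = p \<longrightarrow> 0 < p \<longrightarrow> p < 1 \<longrightarrow>
    (tv_rag_gnp n d \<sigma> p)\<^sup>2
      \<le> C * (real n ^ 3 * (\<Sum>i<d. (influence d \<sigma> i)\<^sup>2)) / (p\<^sup>2 * (1 - p)\<^sup>2)"
  by (rule exI[of _ 1]) (auto intro!: tv_rag_gnp_sq_le)

end
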